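(* The following identities hold as identities of formal power series in $q$: \[ z\mathcal A(z,q)=\frac{q}{1+q}F(z,q)-\frac{q}{1-q^2}, \] \[ z\mathcal B(z,q)=\frac{1-z}{1+q}H(z,q)-\frac{1}{1-q^2}+\frac{z}{(1+q)(1-q^3)}-\frac{zq^2}{1-q^3}, \] and consequently \[ (1+q^2)\mathcal B(z,q)-(1+q)\mathcal A(z,q)=-\frac{q^4}{1-q^3}. \]
   Context: Notation: $(x;q)_0=1$ and $(x;q)_n=\prod_{j=0}^{n-1}(1-xq^j)$; so $(x;q^2)_n=\prod_{j=0}^{n-1}(1-xq^{2j})$. Identities are between formal power series in $q$ (with $z$ an indeterminate). Let $a_2(n;r)$ be the number of partitions of $n$ for which there are integers $l\ge 2$, $1\le k\le l-1$ such that: there are exactly $l-1$ parts equal to $1$; the smallest even part is $2k$; every part greater than $1$ lies in the interval $[2k,2l-2]$; the odd parts greater than $1$ are distinct; and the number of parts greater than $1$, other than one compulsory copy of the smallest even part $2k$, is $r$. Let $b_2(n;r)$ be defined in the same way with the interval $[2k,2l-2]$ replaced by $[2k,2l-1]$. Set \[ \mathcal A(z,q)=\sum_{n\ge0}\sum_{r\ge0}a_2(n;r)z^rq^n=\sum_{\substack{l\ge2\\1\le k\le l-1}}\frac{(-zq^{2k+1};q^2)_{l-k-1}}{(zq^{2k};q^2)_{l-k}}q^{2k+l-1}, \] \[ \mathcal B(z,q)=\sum_{n\ge0}\sum_{r\ge0}b_2(n;r)z^rq^n=\sum_{\substack{l\ge2\\1\le k\le l-1}}\frac{(-zq^{2k+1};q^2)_{l-k}}{(zq^{2k};q^2)_{l-k}}q^{2k+l-1},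 \] \[ F(z,q)=\sum_{n\ge0}\frac{(-zq;q^2)_nq^n}{(zq^2;q^2)_n},\qquad H(z,q)=\sum_{n\ge0}\frac{(-zq;q^2)_nq^n}{(z;q^2)_n}. \] Only the product $(1-z)H(z,q)$ occurs; equivalently $(1-z)H(z,q)=\sum_{n\ge0}(1-zq^{2n})\frac{(-zq;q^2)_nq^n}{(zq^2;q^2)_n}$, which is regular at $z=1$. *)

theory Defs
  imports "HOL-Computational_Algebra.Computational_Algebra"
begin

text \<open>
  All series live in $Q(z)[[q]]$. The coefficients are taken from the field $Q(z)$ rather than
  $Q[z]$ because the denominators $(z;q^2)_n$ of $H$ have the constant coefficient $1 - z$,
  which has to be invertible.
\<close>

type_synonym qz_series = "rat poly fract fps"

definition zz :: qz_series where
  "zz = fps_const (to_fract [:0, 1:])"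

abbreviation qq :: qz_series where
  "qq \<equiv> fps_X"

definition qpoch :: "'a::comm_ring_1 \<Rightarrow> 'a \<Rightarrow> nat \<Rightarrow> 'a" where
  "qpoch x t n = (\<Prod>j<n. 1 - x * t ^ j)"

definition is_partition :: "nat \<Rightarrow> nat multiset \<Rightarrow> bool" where
  "is_partition n p \<longleftrightarrow> 0 \<notin># p \<and> sum_mset p = n"

text \<open>
  The parameter \<open>ub\<close> gives the upper end of the interval of admissible parts as a function
  of \<open>l\<close>. Removing \<open>{#2 * k#}\<close> discards the one compulsory copy of the smallest even part.
\<close>

definition admissible :: "(nat \<Rightarrow> nat) \<Rightarrow> nat \<Rightarrow> nat multiset \<Rightarrow> bool" where
  "admissible ub r p \<longleftrightarrow>
     (\<exists>l k. 2 \<le> l \<and> 1 \<le> k \<and> k \<le> l - 1 \<and>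
        count p 1 = l - 1 \<and>
        2 * k \<in># p \<and> (\<forall>x\<in>#p. even x \<longrightarrow> 2 * k \<le> x) \<and>
        (\<forall>x\<in>#p. 1 < x \<longrightarrow> x \<in> {2 * k..ub l}) \<and>
        (\<forall>x\<in>#p. 1 < x \<and> odd x \<longrightarrow> count p x = 1) \<and>
        size ({#x \<in># p. 1 < x#} - {#2 * k#}) = r)"

definition a2 :: "nat \<Rightarrow> nat \<Rightarrow> nat" where
  "a2 n r = card {p. is_partition n p \<and> admissible (\<lambda>l. 2 * l - 2) r p}"

definition b2 :: "nat \<Rightarrow> nat \<Rightarrow> nat" where
  "b2 n r = card {p. is_partition n p \<and> admissible (\<lambda>l. 2 * l - 1) r p}"

text \<open>
  A partition of \<open>n\<close> has at most \<open>n\<close> parts, so \<open>c n r\<close> vanishes for \<open>r > n\<close> in the cases of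
  interest and the inner sum is the full sum over all \<open>r\<close>.
\<close>

definition gen_fun :: "(nat \<Rightarrow> nat \<Rightarrow> nat) \<Rightarrow> qz_series" where
  "gen_fun c = Abs_fps (\<lambda>n. \<Sum>r\<le>n. of_nat (c n r) * to_fract [:0, 1:] ^ r)"

definition A_series :: qz_series where
  "A_series = gen_fun a2"

definition B_series :: qz_series where
  "B_series = gen_fun b2"

text \<open>The infinite sums converge in the $q$-adic topology carried by the type of power series.\<close>

definition F_series :: qz_series where
  "F_series = (\<Sum>n. qpoch (- (zz * qq)) (qq ^ 2) n * qq ^ n / qpoch (zz * qq ^ 2) (qq ^ 2) n)"

definition H_series :: qz_series where
  "H_series = (\<Sum>n. qpoch (- (zz * qq)) (qq ^ 2) n * qq ^ n / qpoch zz (qq ^ 2) n)"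

end

theory Submission
  imports Defs
begin

text \<open>
  Put \<open>m = l - 1\<close>, the number of parts equal to $1$, and
  $c_m = (-zq;q^2)_m / (zq^2;q^2)_m$, so that $F = \sum_m c_m q^m$ by definition.
  Sorting the partitions counted by \<open>a2\<close> by \<open>m\<close> gives $A = \sum_m q^m s_m$, where $s_m$ sums over
  the smallest even part $2k$ the generating functions of the remaining parts. Everything rests
  on the fact that this finite sum over $k$ has a closed form (\<open>smallest_even_sum_eq\<close>):
  \[ z (1 + q) s_m = q (c_m - 1). \]
  It telescopes: the $k$-th term of $z (1+q) s_m$ is $q$ times the difference of the two tails
  $c_m / c_{k-1}$ and $c_m / c_k$, because
  $(1 + zq^{2k-1}) - (1 - zq^{2k}) = zq^{2k-1}(1 + q)$. The formal proof reads the same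
  cancellation as an induction on $m$, where only the last factors of the products matter.
  Multiplying by $q^m$ and summing over $m$ is the first identity.

  Raising the upper bound on the parts from $2m$ to $2m+1$ permits one more odd part and
  multiplies $s_m$ by $1 + zq^{2m+1}$ (\<open>B_series_eq\<close>), so $B$ is expressed through
  $U = \sum_m q^m (1 + zq^{2m+1}) c_m$ and geometric series.
  The recurrence $(1 - zq^{2m+2}) c_{m+1} = (1 + zq^{2m+1}) c_m$ (\<open>qratio_Suc\<close>) identifies
  $U$ with $H$ up to a shift of the index, as $(1-z)H = \sum_m q^m (1 - zq^{2m}) c_m = 1 - z + qU$.
  This is the second identity. With $Y = \sum_m z q^{3m} c_m$, the series $U$ and $(1-z)H$ are
  also $F + qY$ and $F - Y$, so the shift is a linear relation between $F$ and $Y$;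
  eliminating $Y$ yields the third identity.
\<close>

section \<open>Series in powers of $q$ with power series coefficients\<close>

text \<open>
  This is $\sum_l q^l g_l$, defined coefficientwise, so that linearity and the shift of the
  summation index can be proved without any discussion of convergence.
\<close>

definition qsum :: "(nat \<Rightarrow> 'a::comm_ring_1 fps) \<Rightarrow> 'a fps" where
  "qsum g = Abs_fps (\<lambda>n. \<Sum>l\<le>n. g l $ (n - l))"

lemma qsum_sums: "(\<lambda>l. fps_X ^ l * g l) sums qsum g"
  unfolding sums_def
proof (rule tendsto_fpsI)
  fix n
  have "(\<Sum>l<N. fps_X ^ l * g l) $ n = qsum g $ n" if "n < N" for N
  proof -
    have "(\<Sum>l<N. fps_X ^ l * g l) $ n = (\<Sum>l<N. if n < l then 0 else g l $ (n - l))"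
      by (simp add: fps_sum_nth fps_X_power_mult_nth)
    also have "\<dots> = (\<Sum>l\<le>n. if n < l then 0 else g l $ (n - l))"
      using that by (intro sum.mono_neutral_right) auto
    also have "\<dots> = qsum g $ n"
      by (auto simp: qsum_def intro: sum.cong)
    finally show ?thesis .
  qed
  then show "\<forall>\<^sub>F N in sequentially. (\<Sum>l<N. fps_X ^ l * g l) $ n = qsum g $ n"
    by (rule eventually_mono[OF eventually_gt_at_top[of n]])
qed

lemma qsum_Suc: "qsum g = g 0 + fps_X * qsum (\<lambda>l. g (Suc l))"
proof (rule fps_ext)
  fix n
  show "qsum g $ n = (g 0 + fps_X * qsum (\<lambda>l. g (Suc l))) $ n"
    by (cases n) (simp_all add: qsum_def sum.atMost_Suc_shift del: sum.atMost_Suc)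
qed

lemma qsum_add: "qsum (\<lambda>l. g l + h l) = qsum g + qsum h"
  by (simp add: fps_eq_iff qsum_def sum.distrib)

lemma qsum_diff: "qsum (\<lambda>l. g l - h l) = qsum g - qsum h"
  by (simp add: fps_eq_iff qsum_def sum_subtractf)

text \<open>
  By \<open>qsum_Suc\<close> both sides have the same constant coefficient, and their further coefficients
  are those of the same expression for the shifted family. So induction on the position of the
  coefficient replaces the rearrangement of a double sum.
\<close>

lemma qsum_mult: "qsum (\<lambda>l. c * g l) = c * qsum g"
proof (rule fps_ext)
  fix n
  show "qsum (\<lambda>l. c * g l) $ n = (c * qsum g) $ n"
  proof (induction n arbitrary: g)
    case 0
    show ?case by (simp add: qsum_def)
  next
    case (Suc n)
    have "qsum (\<lambda>l. c * g l) $ Suc n = (c * g 0 + fps_X * (c * qsum (\<lambda>l. g (Suc l)))) $ Suc n"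
      by (subst qsum_Suc) (simp add: Suc.IH)
    also have "c * g 0 + fps_X * (c * qsum (\<lambda>l. g (Suc l))) = c * qsum g"
      by (subst (2) qsum_Suc) (simp add: algebra_simps)
    finally show ?case .
  qed
qed

lemma qsum_geometric: "qsum (\<lambda>l. t ^ l) * (1 - fps_X * t) = 1"
proof -
  have "qsum (\<lambda>l. t ^ l) = 1 + fps_X * (t * qsum (\<lambda>l. t ^ l))"
    by (subst qsum_Suc) (simp add: qsum_mult)
  then show ?thesis by (simp add: algebra_simps)
qed

section \<open>Generating functions of sets of partitions\<close>

definition part_gf :: "'a::comm_ring_1 \<Rightarrow> nat multiset set \<Rightarrow> 'a fps" where
  "part_gf u S = Abs_fps (\<lambda>n. \<Sum>p | p \<in> S \<and> sum_mset p = n. u ^ size p)"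

lemma size_le_sum_mset:
  fixes p :: "nat multiset"
  shows "0 \<notin># p \<Longrightarrow> size p \<le> sum_mset p"
  by (induction p) (auto simp: Suc_le_eq)

lemma finite_partitions: "finite {p :: nat multiset. 0 \<notin># p \<and> sum_mset p = n}"
proof (rule finite_subset)
  show "{p :: nat multiset. 0 \<notin># p \<and> sum_mset p = n} \<subseteq> (\<Union>m\<le>n. multisets_of_size {..n} m)"
  proof safe
    fix p :: "nat multiset"
    assume p: "0 \<notin># p" "n = sum_mset p"
    have "x \<le> sum_mset p" if "x \<in># p" for x
      using that by (auto dest: multi_member_split)
    then show "p \<in> (\<Union>m\<le>sum_mset p. multisets_of_size {..sum_mset p} m)"
      using size_le_sum_mset[OF p(1)] by (auto simp: multisets_of_size_def)
  qed
qed auto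

lemma finite_partitions_subset:
  assumes "\<And>p. p \<in> S \<Longrightarrow> 0 \<notin># p"
  shows "finite {p :: nat multiset. p \<in> S \<and> sum_mset p = n}"
  by (rule finite_subset[OF _ finite_partitions[of n]]) (use assms in auto)

lemma part_gf_Un:
  assumes "\<And>p. p \<in> S \<union> T \<Longrightarrow> 0 \<notin># p" "S \<inter> T = {}"
  shows "part_gf u (S \<union> T) = part_gf u S + part_gf u T"
proof (rule fps_ext)
  fix n
  have "{p. p \<in> S \<union> T \<and> sum_mset p = n} =
      {p. p \<in> S \<and> sum_mset p = n} \<union> {p. p \<in> T \<and> sum_mset p = n}" by auto
  then show "part_gf u (S \<union> T) $ n = (part_gf u S + part_gf u T) $ n"
    using assms by (auto simp: part_gf_def intro!: sum.union_disjoint finite_partitions_subset)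
qed

lemma part_gf_add_mset: "part_gf u (add_mset a ` S) = fps_const u * fps_X ^ a * part_gf u S"
proof (rule fps_ext)
  fix n
  have eq: "{p. p \<in> add_mset a ` S \<and> sum_mset p = n} =
      (if n < a then {} else add_mset a ` {p. p \<in> S \<and> sum_mset p = n - a})"
    by auto
  have inj: "inj_on (add_mset a) T" for T by (simp add: inj_on_def)
  have "part_gf u (add_mset a ` S) $ n = (if n < a then 0 else u * part_gf u S $ (n - a))"
    unfolding part_gf_def fps_nth_Abs_fps eq
    by (simp add: sum.reindex[OF inj] sum_distrib_left)
  then show "part_gf u (add_mset a ` S) $ n = (fps_const u * fps_X ^ a * part_gf u S) $ n"
    by (simp add: mult.assoc fps_X_power_mult_nth)
qed

definition odd_distinct :: "nat set \<Rightarrow> nat multiset set" where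
  "odd_distinct D = {p. set_mset p \<subseteq> D \<and> (\<forall>x. odd x \<longrightarrow> count p x \<le> 1)}"

lemma part_gf_empty: "part_gf u (odd_distinct {}) = 1"
proof -
  have "{p. p \<in> odd_distinct {} \<and> sum_mset p = n} = (if n = 0 then {{#}} else {})" for n
    by (auto simp: odd_distinct_def)
  then show ?thesis by (simp add: part_gf_def fps_eq_iff)
qed

text \<open>A partition either avoids the odd part \<open>a\<close> or uses it once, on top of a partition avoiding it.\<close>

lemma part_gf_insert_odd:
  assumes "0 \<notin> D" "a \<notin> D" "odd a"
  shows "part_gf u (odd_distinct (insert a D)) =
    (1 + fps_const u * fps_X ^ a) * part_gf u (odd_distinct D)"
proof -
  have "odd_distinct (insert a D) = odd_distinct D \<union> add_mset a ` odd_distinct D" (is "?L = ?R")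
  proof (intro equalityI subsetI)
    fix p assume p: "p \<in> ?L"
    show "p \<in> ?R"
    proof (cases "a \<in># p")
      case True
      then obtain p' where p': "p = add_mset a p'" by (auto dest: multi_member_split)
      with p \<open>odd a\<close> have c: "count p' a = 0" 
        by (auto simp: odd_distinct_def dest: spec[of _ a])
      have "count p' x \<le> count p x" for x by (simp add: p')
      then have "count p' x \<le> 1" if "odd x" for x
        using p that by (auto simp: odd_distinct_def intro: order_trans)
      with p c have "p' \<in> odd_distinct D"
        unfolding odd_distinct_def p' by (auto simp: not_in_iff[symmetric])
      then show ?thesis using p' by auto
    qed (use p in \<open>auto simp: odd_distinct_def\<close>)
  next
    fix p assume "p \<in> ?R"
    moreover have "count p a = 0" if "p \<in> odd_distinct D" for p
      using that \<open>a \<notin> D\<close> by (auto simp: odd_distinct_def not_in_iff[symmetric])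
    ultimately show "p \<in> ?L"
      by (auto simp: odd_distinct_def)
  qed
  moreover have "odd_distinct D \<inter> add_mset a ` odd_distinct D = {}"
    using \<open>a \<notin> D\<close> by (auto simp: odd_distinct_def)
  moreover have "0 \<notin># p" if "p \<in> odd_distinct D \<union> add_mset a ` odd_distinct D" for p
    using that assms by (auto simp: odd_distinct_def odd_pos)
  ultimately have "part_gf u (odd_distinct (insert a D)) =
      part_gf u (odd_distinct D) + fps_const u * fps_X ^ a * part_gf u (odd_distinct D)"
    by (metis part_gf_Un part_gf_add_mset)
  then show ?thesis by (simp add: algebra_simps)
qed

text \<open>
  For an even part the recursion is self-referential: once one copy of \<open>a\<close> has been removed,
  further copies may remain. This produces the geometric series in $u q^a$ as a fixed point equation.
\<close>

lemma part_gf_insert_even: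
  assumes "0 \<notin> D" "a \<notin> D" "even a" "a \<noteq> 0"
  shows "(1 - fps_const u * fps_X ^ a) * part_gf u (odd_distinct (insert a D)) =
    part_gf u (odd_distinct D)"
proof -
  let ?I = "odd_distinct (insert a D)"
  have "?I = odd_distinct D \<union> add_mset a ` ?I" (is "?L = ?R")
  proof (intro equalityI subsetI)
    fix p assume p: "p \<in> ?L"
    show "p \<in> ?R"
    proof (cases "a \<in># p")
      case True
      then obtain p' where p': "p = add_mset a p'" by (auto dest: multi_member_split)
      have "count p' x \<le> count p x" for x by (simp add: p')
      then have "count p' x \<le> 1" if "odd x" for x
        using p that by (auto simp: odd_distinct_def intro: order_trans)
      with p have "p' \<in> ?I"
        unfolding odd_distinct_def p' by auto
      then show ?thesis using p' by auto
    qed (use p in \<open>auto simp: odd_distinct_def\<close>)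
  next
    fix p assume "p \<in> ?R"
    then show "p \<in> ?L"
      using \<open>even a\<close> by (auto simp: odd_distinct_def)
  qed
  moreover have "odd_distinct D \<inter> add_mset a ` ?I = {}"
    using \<open>a \<notin> D\<close> by (auto simp: odd_distinct_def)
  moreover have "0 \<notin># p" if "p \<in> odd_distinct D \<union> add_mset a ` ?I" for p
    using that assms by (auto simp: odd_distinct_def)
  ultimately have "part_gf u ?I = part_gf u (odd_distinct D) + fps_const u * fps_X ^ a * part_gf u ?I"
    by (metis part_gf_Un part_gf_add_mset)
  then show ?thesis by (simp add: algebra_simps)
qed

section \<open>Decomposition of admissible partitions\<close>

text \<open>
  An admissible partition consists of \<open>m\<close> ones, the compulsory part \<open>2 * k\<close> and a free remainder
  with parts in \<open>{2 * k..d m}\<close>, where \<open>m\<close> is the \<open>l - 1\<close> of the definition and \<open>d m\<close> its upper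
  bound. The remainder may contain further copies of \<open>2 * k\<close>.
\<close>

lemma admissible_partitions_eq_image:
  fixes n r :: nat and d :: "nat \<Rightarrow> nat"
  assumes d: "\<And>m. 2 * m \<le> d m" "\<And>l. ub (Suc l) = d l"
  shows "{p. is_partition n p \<and> admissible ub r p} =
    (\<lambda>(m, k, p). replicate_mset m 1 + add_mset (2 * k) p) `
      {(m, k, p). 1 \<le> k \<and> k \<le> m \<and> p \<in> odd_distinct {2 * k..d m} \<and>
         m + 2 * k + sum_mset p = n \<and> size p = r}" (is "?L = ?f ` ?R")
proof (intro equalityI subsetI)
  fix p assume "p \<in> ?L"
  then obtain l k where p: "0 \<notin># p" "sum_mset p = n" and lk: "2 \<le> l" "1 \<le> k" "k \<le> l - 1"
    and c1: "count p 1 = l - 1" and k: "2 * k \<in># p" 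
    and int: "\<And>x. x \<in># p \<Longrightarrow> 1 < x \<Longrightarrow> x \<in> {2 * k..ub l}"
    and od: "\<And>x. x \<in># p \<Longrightarrow> 1 < x \<Longrightarrow> odd x \<Longrightarrow> count p x = 1"
    and r: "size ({#x \<in># p. 1 < x#} - {#2 * k#}) = r"
    unfolding is_partition_def admissible_def by blast
  define m where "m = l - 1"
  have l: "l = Suc m" using lk by (simp add: m_def)
  define p' where "p' = {#x \<in># p. 1 < x#} - {#2 * k#}"
  have big: "{#x \<in># p. 1 < x#} = add_mset (2 * k) p'"
    using k lk by (simp add: p'_def)
  have "p = replicate_mset m 1 + {#x \<in># p. 1 < x#}"
  proof (rule multiset_eqI)
    fix x
    show "count p x = count (replicate_mset m 1 + {#x \<in># p. 1 < x#}) x"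
      using p(1) c1 by (cases "x = 0"; cases "x = 1") (auto simp: m_def not_in_iff)
  qed
  then have pm: "p = replicate_mset m 1 + add_mset (2 * k) p'" using big by simp
  have sub: "x \<in># p" "1 < x" if "x \<in># p'" for x
    using that by (auto simp: p'_def dest: in_diffD)
  have "count p' x \<le> 1" if "odd x" for x
  proof (cases "x \<in># p'")
    case True
    have "count p' x \<le> count p x" by (simp add: p'_def)
    with od[OF sub[OF True]] that show ?thesis by simp
  qed (simp add: not_in_iff)
  then have "p' \<in> odd_distinct {2 * k..d m}"
    using int[OF sub] d(2) by (auto simp: odd_distinct_def l)
  moreover have "m + 2 * k + sum_mset p' = n"
    using p(2) by (subst (asm) pm) simp
  ultimately have "(m, k, p') \<in> ?R"
    using lk l r by (simp add: p'_def)
  moreover have "p = ?f (m, k, p')" using pm by simp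
  ultimately show "p \<in> ?f ` ?R" by (rule rev_image_eqI)
next
  fix p assume "p \<in> ?f ` ?R"
  then obtain m k p' where p: "p = replicate_mset m 1 + add_mset (2 * k) p'"
    and k: "1 \<le> k" "k \<le> m" and p': "p' \<in> odd_distinct {2 * k..d m}"
    and n: "m + 2 * k + sum_mset p' = n" and r: "size p' = r"
    by auto
  have ge: "x \<in> {2 * k..d m}" if "x \<in># p'" for x using that p' by (auto simp: odd_distinct_def)
  have big: "{#x \<in># p. 1 < x#} = add_mset (2 * k) p'"
  proof -
    have "{#x \<in># p'. 1 < x#} = p'"
      using ge k by (intro filter_mset_eq_conv[THEN iffD2]) force
    moreover have "{#x \<in># replicate_mset m (1::nat). 1 < x#} = {#}" by (induction m) auto
    ultimately show ?thesis using k by (simp add: p)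
  qed
  have "is_partition n p"
    using n k ge by (fastforce simp: is_partition_def p)
  moreover have "admissible ub r p"
    unfolding admissible_def
  proof (rule exI[of _ "Suc m"], rule exI[of _ k], intro conjI ballI impI)
    show "count p 1 = Suc m - 1"
      using ge k by (force simp: p count_eq_zero_iff)
    show "2 * k \<in># p" by (simp add: p)
    show "size ({#x \<in># p. 1 < x#} - {#2 * k#}) = r" using r big by simp
    show "2 * k \<le> x" if "x \<in># p" "even x" for x
      using that ge by (auto simp: p split: if_splits)
    show "x \<in> {2 * k..ub (Suc m)}" if "x \<in># p" "1 < x" for x
      using that ge d k order.trans[OF _ d(1)[of m], of "2 * k"] by (auto simp: p split: if_splits)
    show "count p x = 1" if "x \<in># p" and "1 < x \<and> odd x" for x
    proof -
      have x: "x \<in># p'" using that by (auto simp: p split: if_splits)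
      then have "1 \<le> count p' x" by (simp only: count_greater_eq_one_iff)
      moreover have "count p' x \<le> 1" using p' that by (auto simp: odd_distinct_def)
      moreover have "count p x = count p' x" using that by (auto simp: p)
      ultimately show ?thesis by linarith
    qed
  qed (use k in auto)
  ultimately show "p \<in> ?L" by simp
qed

text \<open>
  The number of ones determines \<open>m\<close> and the smallest even part determines \<open>k\<close>, hence no partition
  is counted for two different pairs in the existential quantifier of \<^const>\<open>admissible\<close>.
\<close>

lemma inj_on_attach:
  fixes d :: "nat \<Rightarrow> nat"
  shows "inj_on (\<lambda>(m, k, p). replicate_mset m 1 + add_mset (2 * k) p)
    {(m, k, p). 1 \<le> k \<and> p \<in> odd_distinct {2 * k..d m}}"
    (is "inj_on ?f ?T")
proof (rule inj_onI)
  fix x y assume "x \<in> ?T" "y \<in> ?T" "?f x = ?f y"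
  then obtain m k p m' k' p' where xy: "x = (m, k, p)" "y = (m', k', p')"
    and eq: "replicate_mset m 1 + add_mset (2 * k) p =
      replicate_mset m' 1 + add_mset (2 * k') p'" (is "?P = ?P'")
    and k: "1 \<le> k" "1 \<le> k'"
    and p: "p \<in> odd_distinct {2 * k..d m}" "p' \<in> odd_distinct {2 * k'..d m'}"
    by (cases x, cases y) auto
  have ge: "2 * k \<le> x" if "x \<in># p" for x using that p(1) by (auto simp: odd_distinct_def)
  have ge': "2 * k' \<le> x" if "x \<in># p'" for x using that p(2) by (auto simp: odd_distinct_def)
  have "count ?P 1 = m" "count ?P' 1 = m'"
    using k ge[of 1] ge'[of 1] by (auto simp: count_eq_zero_iff)
  then have m: "m = m'" using eq by metis
  have eq2: "add_mset (2 * k) p = add_mset (2 * k') p'" using eq m by simp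
  have "2 * k \<in># add_mset (2 * k') p'" "2 * k' \<in># add_mset (2 * k) p" 
    using eq2 by (metis union_single_eq_member)+
  then have "k = k'" using ge[of "2 * k'"] ge'[of "2 * k"] by auto
  with m eq2 xy show "x = y" by simp
qed

lemma gen_fun_admissible:
  fixes d :: "nat \<Rightarrow> nat"
  assumes d: "\<And>m. 2 * m \<le> d m" "\<And>l. ub (Suc l) = d l"
  shows "gen_fun (\<lambda>n r. card {p. is_partition n p \<and> admissible ub r p}) =
    qsum (\<lambda>m. \<Sum>k=1..m. qq ^ (2 * k) * part_gf (to_fract [:0, 1:]) (odd_distinct {2 * k..d m}))"
    (is "?lhs = ?rhs")
proof (rule fps_ext)
  fix n
  let ?u = "to_fract [:0, 1:] :: rat poly fract"
  \<comment> \<open>The conditions \<open>2 * k \<le> n - m\<close> and \<open>m \<le> n\<close> in \<open>K\<close> and \<open>T\<close> keep the truncated subtraction exact.\<close>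
  define P where "P m k = {p. p \<in> odd_distinct {2 * k..d m} \<and> sum_mset p = n - m - 2 * k}" for m k
  define K where "K m = {k \<in> {1..m}. 2 * k \<le> n - m}" for m
  define T where "T = Sigma {..n} (\<lambda>m. Sigma (K m) (P m))"
  have finP: "finite (P m k)" if "k \<in> K m" for m k
    unfolding P_def by (rule finite_partitions_subset) (use that in \<open>auto simp: odd_distinct_def K_def\<close>)
  have finT: "finite T" 
    unfolding T_def by (intro finite_SigmaI finP) (auto simp: K_def)
  have T: "{(m, k, p). 1 \<le> k \<and> k \<le> m \<and> p \<in> odd_distinct {2 * k..d m} \<and>
         m + 2 * k + sum_mset p = n \<and> size p = r} = {x \<in> T. size (snd (snd x)) = r}" for r
    by (auto simp: T_def K_def P_def)
  have size_le: "size (snd (snd x)) \<le> n" if x: "x \<in> T" for x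
  proof -
    obtain m k p where [simp]: "x = (m, k, p)" by (cases x)
    have "0 \<notin># p" "sum_mset p \<le> n" using x by (auto simp: T_def K_def P_def odd_distinct_def)
    then show ?thesis using size_le_sum_mset[of p] by simp
  qed
  have "card {p. is_partition n p \<and> admissible ub r p} = card {x \<in> T. size (snd (snd x)) = r}" for r
    unfolding admissible_partitions_eq_image[OF d] 
    by (subst T[symmetric], rule card_image, rule inj_on_subset[OF inj_on_attach[of d]]) auto
  then have "?lhs $ n = (\<Sum>r\<le>n. \<Sum>x | x \<in> T \<and> size (snd (snd x)) = r. ?u ^ size (snd (snd x)))"
    by (simp add: gen_fun_def)
  also have "\<dots> = (\<Sum>x\<in>T. ?u ^ size (snd (snd x)))"
    using size_le by (intro sum.group finT) auto
  also have "\<dots> = (\<Sum>m\<le>n. \<Sum>k\<in>K m. \<Sum>p\<in>P m k. ?u ^ size p)"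
  proof -
    have "(\<Sum>k\<in>K m. \<Sum>p\<in>P m k. ?u ^ size p) =
        (\<Sum>x\<in>Sigma (K m) (P m). ?u ^ size (snd x))" for m
      using finP by (subst sum.Sigma) (auto simp: K_def intro!: sum.cong)
    then have "(\<Sum>m\<le>n. \<Sum>k\<in>K m. \<Sum>p\<in>P m k. ?u ^ size p) =
        (\<Sum>m\<le>n. \<Sum>x\<in>Sigma (K m) (P m). ?u ^ size (snd x))" by simp
    also have "\<dots> = (\<Sum>x\<in>T. ?u ^ size (snd (snd x)))"
      unfolding T_def using finP
      by (subst sum.Sigma) (auto simp: K_def intro!: sum.cong finite_SigmaI)
    finally show ?thesis ..
  qed
  also have "\<dots> = (\<Sum>m\<le>n. \<Sum>k=1..m. if n - m < 2 * k then 0 else \<Sum>p\<in>P m k. ?u ^ size p)"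
    by (intro sum.cong refl sum.mono_neutral_cong_left) (auto simp: K_def)
  also have "\<dots> = ?rhs $ n"
    by (simp add: qsum_def fps_sum_nth fps_X_power_mult_nth part_gf_def P_def cong: if_cong)
  finally show "?lhs $ n = ?rhs $ n" .
qed

section \<open>The telescoping sum over the smallest even part\<close>

definition smallest_even_sum :: "nat \<Rightarrow> qz_series" where
  "smallest_even_sum m =
     (\<Sum>k=1..m. qq ^ (2 * k) * part_gf (to_fract [:0, 1:]) (odd_distinct {2 * k..2 * m}))"

lemma A_series_eq: "A_series = qsum smallest_even_sum"
  unfolding A_series_def a2_def smallest_even_sum_def
  by (rule gen_fun_admissible) auto

lemma part_gf_interval_odd:
  assumes "1 \<le> k" "k \<le> m"
  shows "part_gf u (odd_distinct {2 * k..2 * m + 1}) =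
    (1 + fps_const u * fps_X ^ (2 * m + 1)) * part_gf u (odd_distinct {2 * k..2 * m})"
proof -
  have "{2 * k..2 * m + 1} = insert (2 * m + 1) {2 * k..2 * m}" using assms by auto
  then show ?thesis using assms by (simp add: part_gf_insert_odd)
qed

lemma B_series_eq: "B_series = qsum (\<lambda>m. (1 + zz * qq * (qq ^ 2) ^ m) * smallest_even_sum m)"
proof -
  have "B_series = qsum (\<lambda>m. \<Sum>k=1..m. qq ^ (2 * k) *
      part_gf (to_fract [:0, 1:]) (odd_distinct {2 * k..2 * m + 1}))"
    unfolding B_series_def b2_def by (rule gen_fun_admissible) auto
  also have "\<dots> = qsum (\<lambda>m. (1 + zz * qq * (qq ^ 2) ^ m) * smallest_even_sum m)"
  proof (intro arg_cong[of _ _ qsum] ext)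
    fix m
    have "qq ^ (2 * k) * part_gf (to_fract [:0, 1:]) (odd_distinct {2 * k..2 * m + 1}) =
        (1 + zz * qq * (qq ^ 2) ^ m) *
          (qq ^ (2 * k) * part_gf (to_fract [:0, 1:]) (odd_distinct {2 * k..2 * m}))"
      if "k \<in> {1..m}" for k
      using that part_gf_interval_odd[of k m "to_fract [:0, 1:] :: rat poly fract"]
      by (simp add: zz_def power_mult[symmetric] mult_ac)
    then show "(\<Sum>k=1..m. qq ^ (2 * k) *
          part_gf (to_fract [:0, 1:]) (odd_distinct {2 * k..2 * m + 1})) =
        (1 + zz * qq * (qq ^ 2) ^ m) * smallest_even_sum m"
      unfolding smallest_even_sum_def sum_distrib_left by (intro sum.cong refl)
  qed
  finally show ?thesis .
qed

text \<open>
  Raising the bound from \<open>2 * m\<close> to \<open>2 * m + 2\<close> adds the same odd and the same even part to every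
  term; the inhomogeneous term comes from the new smallest part \<open>2 * m + 2\<close>.
\<close>

lemma smallest_even_sum_Suc:
  "(1 - zz * qq ^ (2 * m + 2)) * smallest_even_sum (Suc m) =
     (1 + zz * qq ^ (2 * m + 1)) * smallest_even_sum m + qq ^ (2 * m + 2)"
proof -
  let ?g = "\<lambda>k m. part_gf (to_fract [:0, 1:] :: rat poly fract) (odd_distinct {2 * k..2 * m})"
  have rec: "(1 - zz * qq ^ (2 * m + 2)) * ?g k (Suc m) = 
      part_gf (to_fract [:0, 1:]) (odd_distinct {2 * k..2 * m + 1})"
    if "1 \<le> k" "k \<le> Suc m" for k
  proof -
    have "{2 * k..2 * Suc m} = insert (2 * m + 2) {2 * k..2 * m + 1}" using that by auto
    then show ?thesis using that part_gf_insert_even[of "{2 * k..2 * m + 1}" "2 * m + 2"]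
      by (simp add: zz_def)
  qed
  have old: "(1 - zz * qq ^ (2 * m + 2)) * ?g k (Suc m) = (1 + zz * qq ^ (2 * m + 1)) * ?g k m"
    if "1 \<le> k" "k \<le> m" for k
    using rec[of k] part_gf_interval_odd[of k m] that by (simp add: zz_def)
  have new: "(1 - zz * qq ^ (2 * m + 2)) * ?g (Suc m) (Suc m) = 1"
    using rec[of "Suc m"] by (simp add: part_gf_empty)
  have "(1 - zz * qq ^ (2 * m + 2)) * smallest_even_sum (Suc m) =
      (\<Sum>k=1..m. qq ^ (2 * k) * ((1 - zz * qq ^ (2 * m + 2)) * ?g k (Suc m)))
      + qq ^ (2 * m + 2) * ((1 - zz * qq ^ (2 * m + 2)) * ?g (Suc m) (Suc m))"
    by (simp add: smallest_even_sum_def sum_distrib_left distrib_left mult_ac)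
  also have "\<dots> = (\<Sum>k=1..m. qq ^ (2 * k) * ((1 + zz * qq ^ (2 * m + 1)) * ?g k m)) + qq ^ (2 * m + 2)"
    unfolding new by (intro arg_cong2[of _ _ _ _ "(+)"] sum.cong) (simp_all add: old[simplified])
  also have "\<dots> = (1 + zz * qq ^ (2 * m + 1)) * smallest_even_sum m + qq ^ (2 * m + 2)"
    by (simp add: smallest_even_sum_def sum_distrib_left mult_ac)
  finally show ?thesis .
qed

text \<open>The coefficients $c_n$ of the series $F$.\<close>

definition qratio :: "nat \<Rightarrow> qz_series" where
  "qratio n = qpoch (- (zz * qq)) (qq ^ 2) n / qpoch (zz * qq ^ 2) (qq ^ 2) n"

lemma fps_mult_divide_cancel:
  fixes a b :: "'a::field fps"
  assumes "b $ 0 \<noteq> 0"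
  shows "b * (a / b) = a"
  using assms by (simp add: fps_divide_unit inverse_mult_eq_1' mult.left_commute)

lemma qpoch_nth_0: "qpoch x t n $ 0 = qpoch (x $ 0) (t $ 0 :: 'a::comm_ring_1) n"
  by (induction n) (simp_all add: qpoch_def fps_power_zeroth)

lemma qpoch_denominator_nth_0: "qpoch (zz * qq ^ 2) (qq ^ 2) n $ 0 \<noteq> 0"
  by (simp only: qpoch_nth_0) (simp add: qpoch_def)

lemma qratio_0: "qratio 0 = 1"
  by (simp add: qratio_def qpoch_def)

lemma qratio_Suc:
  "(1 - zz * qq ^ (2 * n + 2)) * qratio (Suc n) = (1 + zz * qq ^ (2 * n + 1)) * qratio n"
proof -
  let ?N = "\<lambda>n. qpoch (- (zz * qq)) (qq ^ 2) n" and ?D = "\<lambda>n. qpoch (zz * qq ^ 2) (qq ^ 2) n"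
  have N: "?N (Suc n) = ?N n * (1 + zz * qq ^ (2 * n + 1))"
    and D: "?D (Suc n) = ?D n * (1 - zz * qq ^ (2 * n + 2))"
    by (simp_all add: qpoch_def power_mult[symmetric] power_add[symmetric] mult.assoc)
  have R: "?D n * qratio n = ?N n" for n
    unfolding qratio_def by (rule fps_mult_divide_cancel[OF qpoch_denominator_nth_0])
  have "?D n * ((1 - zz * qq ^ (2 * n + 2)) * qratio (Suc n)) =
      ?D n * ((1 + zz * qq ^ (2 * n + 1)) * qratio n)"
    using R[of n] R[of "Suc n"] unfolding N D by (simp add: mult_ac)
  moreover have "?D n \<noteq> 0" using qpoch_denominator_nth_0[of n] by auto
  ultimately show ?thesis by simp
qed

text \<open>
  Up to the common factors, \<^const>\<open>smallest_even_sum\<close> and \<^const>\<open>qratio\<close> are multiplied by the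
  same ratio in each step, and the inhomogeneous term of the former is what the constant $-1$ needs:
  $-(1 + zq^{2m+1}) + z(1+q)q^{2m+1} = -(1 - zq^{2m+2})$.
\<close>

lemma smallest_even_sum_eq: "zz * (1 + qq) * smallest_even_sum m = qq * (qratio m - 1)"
proof (induction m)
  case 0
  show ?case by (simp add: smallest_even_sum_def qratio_0)
next
  case (Suc m)
  let ?d = "1 - zz * qq ^ (2 * m + 2)" and ?n = "1 + zz * qq ^ (2 * m + 1)"
  have "?d * (zz * (1 + qq) * smallest_even_sum (Suc m)) =
      ?n * (zz * (1 + qq) * smallest_even_sum m) + zz * (1 + qq) * qq ^ (2 * m + 2)"
    (is "?d * (?w * ?s') = ?n * (?w * ?s) + ?w * ?e")
  proof -
    have "?d * (?w * ?s') = ?w * (?d * ?s')" by (simp only: mult_ac)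
    also have "\<dots> = ?n * (?w * ?s) + ?w * ?e"
      unfolding smallest_even_sum_Suc by (simp only: distrib_left[of ?w] mult.left_commute[of ?w])
    finally show ?thesis .
  qed
  also have "\<dots> = qq * (?n * qratio m) - qq * ?d"
    unfolding Suc.IH by (simp add: algebra_simps)
  also have "\<dots> = ?d * (qq * (qratio (Suc m) - 1))"
    by (simp only: qratio_Suc[symmetric] right_diff_distrib mult.left_commute[of ?d] mult_1_right
        mult.commute[of ?d qq])
  finally have "?d * (zz * (1 + qq) * smallest_even_sum (Suc m)) = ?d * (qq * (qratio (Suc m) - 1))" .
  moreover have "?d $ 0 \<noteq> 0" by simp
  then have "?d \<noteq> 0" by (metis fps_zero_nth)
  ultimately show ?case by (simp only: mult_cancel_left) simp
qed

section \<open>The identities\<close>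

lemma F_series_eq: "F_series = qsum qratio"
proof -
  have "qpoch (- (zz * qq)) (qq ^ 2) n * qq ^ n / qpoch (zz * qq ^ 2) (qq ^ 2) n = qq ^ n * qratio n" for n
    using qpoch_denominator_nth_0[of n] by (simp add: qratio_def fps_divide_unit mult_ac)
  then show ?thesis
    unfolding F_series_def by (simp add: sums_unique[OF qsum_sums, symmetric])
qed

lemma one_minus_zz_nth_0: "(1 - zz) $ 0 \<noteq> 0"
proof -
  have "to_fract [:0, 1:] \<noteq> (to_fract 1 :: rat poly fract)"
    by (simp only: to_fract_eq_iff) (simp add: one_pCons)
  then show ?thesis by (simp add: zz_def)
qed

text \<open>
  Multiplication by $1 - z$ trades the denominator $(z;q^2)_n$ for $(zq^2;q^2)_n$, as
  $(z;q^2)_n (1 - zq^{2n})$ and $(1 - z) (zq^2;q^2)_n$ are two factorizations of $(z;q^2)_{n+1}$.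
\<close>

lemma H_series_eq: "(1 - zz) * H_series = qsum (\<lambda>n. (1 - zz * (qq ^ 2) ^ n) * qratio n)"
proof -
  let ?N = "\<lambda>n. qpoch (- (zz * qq)) (qq ^ 2) n" and ?D = "\<lambda>n. qpoch (zz * qq ^ 2) (qq ^ 2) n"
    and ?Z = "\<lambda>n. qpoch zz (qq ^ 2) n"
  have Z: "?Z n $ 0 \<noteq> 0" for n
  proof -
    have "qpoch (zz $ 0) 0 n \<noteq> 0"
      using one_minus_zz_nth_0
      by (cases n) (simp_all add: qpoch_def prod.lessThan_Suc_shift del: prod.lessThan_Suc)
    then show ?thesis by (simp only: qpoch_nth_0) simp
  qed
  have "(1 - zz) * (?N n / ?Z n) = (1 - zz * (qq ^ 2) ^ n) * qratio n" for n
  proof -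
    have ZD: "?Z n * (1 - zz * (qq ^ 2) ^ n) = (1 - zz) * ?D n"
    proof -
      have "?Z n * (1 - zz * (qq ^ 2) ^ n) = ?Z (Suc n)" by (simp add: qpoch_def)
      also have "\<dots> = (1 - zz) * ?D n"
        unfolding qpoch_def by (subst prod.lessThan_Suc_shift) (simp add: mult_ac)
      finally show ?thesis .
    qed
    have DN: "?D n * qratio n = ?N n"
      unfolding qratio_def by (rule fps_mult_divide_cancel[OF qpoch_denominator_nth_0])
    have ZN: "?Z n * (?N n / ?Z n) = ?N n" by (rule fps_mult_divide_cancel[OF Z])
    have "?Z n * ((1 - zz) * (?N n / ?Z n)) = (1 - zz) * ?D n * qratio n"
      by (simp only: mult.left_commute[of "?Z n"] ZN mult.assoc DN)
    also have "\<dots> = ?Z n * ((1 - zz * (qq ^ 2) ^ n) * qratio n)"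
      by (simp only: ZD[symmetric] mult.assoc)
    finally have "?Z n * ((1 - zz) * (?N n / ?Z n)) = ?Z n * ((1 - zz * (qq ^ 2) ^ n) * qratio n)" .
    moreover have "?Z n \<noteq> 0" using Z[of n] by auto
    ultimately show ?thesis by simp
  qed
  then have "qsum (\<lambda>n. (1 - zz * (qq ^ 2) ^ n) * qratio n) = (1 - zz) * qsum (\<lambda>n. ?N n / ?Z n)"
    by (simp flip: qsum_mult)
  moreover have "?N n * qq ^ n / ?Z n = qq ^ n * (?N n / ?Z n)" for n
    using Z[of n] by (simp add: fps_divide_unit mult_ac)
  then have "H_series = qsum (\<lambda>n. ?N n / ?Z n)"
    unfolding H_series_def by (simp add: sums_unique[OF qsum_sums, symmetric])
  ultimately show ?thesis by simp
qed

theorem mainTheorem1: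
  shows "zz * A_series = qq / (1 + qq) * F_series - qq / (1 - qq ^ 2) \<and>
    zz * B_series = (1 - zz) / (1 + qq) * H_series - 1 / (1 - qq ^ 2)
       + zz / ((1 + qq) * (1 - qq ^ 3)) - zz * qq ^ 2 / (1 - qq ^ 3) \<and>
    (1 + qq ^ 2) * B_series - (1 + qq) * A_series = - (qq ^ 4) / (1 - qq ^ 3)"
proof -
  define U where "U = qsum (\<lambda>n. (1 + zz * qq * (qq ^ 2) ^ n) * qratio n)"
  define Y where "Y = qsum (\<lambda>n. zz * (qq ^ 2) ^ n * qratio n)"
  \<comment> \<open>Naming the inverses turns all divisions into polynomial relations.\<close>
  define G1 where "G1 = inverse (1 - qq)"
  define G3 where "G3 = inverse (1 - qq ^ 3)"
  define P where "P = inverse (1 + qq)"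
  have G1: "G1 * (1 - qq) = 1" unfolding G1_def by (rule inverse_mult_eq_1) simp
  have G3: "G3 * (1 - qq ^ 3) = 1" unfolding G3_def by (rule inverse_mult_eq_1) simp
  have P: "P * (1 + qq) = 1" unfolding P_def by (rule inverse_mult_eq_1) simp
  have d1: "a / (1 + qq) = a * P" for a unfolding P_def by (rule fps_divide_unit) simp
  have d3: "a / (1 - qq ^ 3) = a * G3" for a unfolding G3_def by (rule fps_divide_unit) simp
  have d2: "a / (1 - qq ^ 2) = a * (P * G1)" for a
  proof -
    have "1 - qq ^ 2 = (1 + qq) * (1 - qq)" by (simp add: algebra_simps power2_eq_square)
    then have "inverse (1 - qq ^ 2) = P * G1" by (simp only: P_def G1_def fps_inverse_mult)
    then show ?thesis by (subst fps_divide_unit) simp_all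
  qed
  have d13: "a / ((1 + qq) * (1 - qq ^ 3)) = a * (P * G3)" for a
    unfolding P_def G3_def by (simp add: fps_divide_unit fps_inverse_mult)
  have cancel: "a = b" if "(1 + qq) * a = (1 + qq) * b" for a b :: qz_series
    using that P by algebra
  have geo1: "qsum (\<lambda>n. 1) = G1"
    using qsum_geometric[of "1 :: qz_series"] G1 by simp algebra
  have geo3: "qsum (\<lambda>n. (qq ^ 2) ^ n) = G3"
    using qsum_geometric[of "qq ^ 2"] G3 by algebra

  have A: "zz * (1 + qq) * A_series = qq * (F_series - G1)"
    by (simp add: A_series_eq F_series_eq flip: qsum_mult qsum_diff geo1)
       (simp add: smallest_even_sum_eq)
  have B: "zz * (1 + qq) * B_series = qq * (U - G1 - zz * qq * G3)"
  proof -
    have "zz * (1 + qq) * B_series =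
        qsum (\<lambda>m. (1 + zz * qq * (qq ^ 2) ^ m) * (zz * (1 + qq) * smallest_even_sum m))"
      by (simp add: B_series_eq mult_ac flip: qsum_mult)
    also have "\<dots> = qq * (U - G1 - zz * qq * G3)"
      unfolding smallest_even_sum_eq U_def
      by (simp add: algebra_simps flip: qsum_mult qsum_diff qsum_add geo1 geo3)
    finally show ?thesis .
  qed
  have H: "(1 - zz) * H_series = 1 - zz + qq * U"
  proof -
    have "(1 - zz) * H_series = (1 - zz * (qq ^ 2) ^ 0) * qratio 0 +
        qq * qsum (\<lambda>n. (1 - zz * (qq ^ 2) ^ Suc n) * qratio (Suc n))"
      unfolding H_series_eq by (rule qsum_Suc)
    also have "(\<lambda>n. (1 - zz * (qq ^ 2) ^ Suc n) * qratio (Suc n)) =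
        (\<lambda>n. (1 + zz * qq * (qq ^ 2) ^ n) * qratio n)"
    proof
      fix n
      show "(1 - zz * (qq ^ 2) ^ Suc n) * qratio (Suc n) =
          (1 + zz * qq * (qq ^ 2) ^ n) * qratio n"
        using qratio_Suc[of n] by (simp add: power_mult[symmetric] power_add[symmetric] mult.assoc)
    qed
    finally show ?thesis by (simp add: U_def qratio_0)
  qed
  \<comment> \<open>Inserting \<open>UY\<close> and \<open>HY\<close> into \<open>H\<close> gives $(1 - q) F - (1 + q^2) Y = 1 - z$, which eliminates $Y$.\<close>
  have UY: "U = F_series + qq * Y"
    unfolding U_def Y_def F_series_eq by (simp add: algebra_simps flip: qsum_mult qsum_add)
  have HY: "(1 - zz) * H_series = F_series - Y"
    unfolding H_series_eq Y_def F_series_eq by (simp add: algebra_simps flip: qsum_diff)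

  have "zz * A_series = qq / (1 + qq) * F_series - qq / (1 - qq ^ 2)"
    unfolding d1 d2 using A P by algebra
  moreover have "zz * B_series = (1 - zz) / (1 + qq) * H_series - 1 / (1 - qq ^ 2)
       + zz / ((1 + qq) * (1 - qq ^ 3)) - zz * qq ^ 2 / (1 - qq ^ 3)"
    unfolding d1 d2 d3 d13 using B H P G1 G3 by algebra
  moreover have "(1 + qq ^ 2) * B_series - (1 + qq) * A_series = - (qq ^ 4) / (1 - qq ^ 3)"
  proof -
    have FY: "(1 - qq) * F_series - (1 + qq ^ 2) * Y = 1 - zz"
      using H HY UY by algebra
    have "zz * ((1 + qq) * ((1 + qq ^ 2) * B_series - (1 + qq) * A_series)) =
        (1 + qq ^ 2) * (zz * (1 + qq) * B_series) - (1 + qq) * (zz * (1 + qq) * A_series)"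
      by algebra
    also have "\<dots> = qq ^ 2 * (G1 * (1 - qq)) -
        qq ^ 2 * ((1 - qq) * F_series - (1 + qq ^ 2) * Y) - (1 + qq ^ 2) * zz * qq ^ 2 * G3"
      unfolding A B UY by algebra
    also have "\<dots> = zz * qq ^ 2 * (1 - (1 + qq ^ 2) * G3)"
      unfolding G1 FY by algebra
    also have "\<dots> = zz * ((1 + qq) * (- (qq ^ 4) * G3))"
      using G3 by algebra
    finally have eq: "zz * ((1 + qq) * ((1 + qq ^ 2) * B_series - (1 + qq) * A_series)) =
        zz * ((1 + qq) * (- (qq ^ 4) * G3))" .
    have "zz \<noteq> 0" by (simp add: zz_def)
    then have "(1 + qq) * ((1 + qq ^ 2) * B_series - (1 + qq) * A_series) =
        (1 + qq) * (- (qq ^ 4) * G3)" by (rule mult_left_cancel[THEN iffD1, OF _ eq])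
    then show ?thesis unfolding d3 by (rule cancel)
  qed
  ultimately show ?thesis by blast
qed

end
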